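(* For all odd integers $d>1$ and $g_0\ge 3$ and every integer $\Delta>d$, \[ \chi'_d(R(\Delta,g_0))=\left\lceil\frac{\Delta g_0-1}{d g_0-1}\right\rceil , \] where $R(\Delta,g_0)$ is the almost full ring graph.
   Context: Multigraphs are finite and loopless; parallel edges are allowed. For a positive integer $d$, a $d$-defective edge coloring of a multigraph $G$ is an assignment of colors to the edges of $G$ such that, for each color, the subgraph formed by the edges of that color has maximum degree at most $d$ (degrees count edges with multiplicity). The $d$-defective chromatic index $\chi'_d(G)$ is the least $k$ such that $G$ has a $d$-defective edge coloring using at most $k$ colors. For a positive integer $\Delta$ and an odd integer $g_0\ge 3$, the almost full ring graph $R(\Delta,g_0)$ is the multigraph whose underlying graph is the cycle $v_1v_2\cdots v_{g_0}v_1$ and in which the number of parallel edges joining $v_i$ and $v_{i+1}$, for $1\le i\le g_0-1$, is $\lfloor\Delta/2\rfloor$ if $i$ is odd and $\lceil\Delta/2\rceil$ if $i$ is even, and the number of parallel edges joining $v_{g_0}$ and $v_1$ is $\lfloor\Delta/2\rfloor$. *)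

theory Defs
  imports Complex_Main
begin

text \<open>
  Undirected multigraphs. Edges are individual objects mapped to their set of
  end vertices, so that parallel edges are distinct edges with the same ends.
\<close>

record ('v, 'e) multigraph =
  verts :: "'v set"
  edges :: "'e set"
  ends :: "'e \<Rightarrow> 'v set"

locale finite_loopless_multigraph =
  fixes G :: "('v, 'e) multigraph"
  assumes finite_verts: "finite (verts G)"
    and finite_edges: "finite (edges G)"
    and ends_in_verts: "e \<in> edges G \<Longrightarrow> ends G e \<subseteq> verts G"
    and loopless: "e \<in> edges G \<Longrightarrow> card (ends G e) = 2"

definition degree :: "('v, 'e) multigraph \<Rightarrow> 'v \<Rightarrow> nat" where
  "degree G v = card {e \<in> edges G. v \<in> ends G e}"

text \<open>The inserted 0 only matters for the graph without vertices.\<close>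

definition max_degree :: "('v, 'e) multigraph \<Rightarrow> nat" where
  "max_degree G = Max (insert 0 (degree G ` verts G))"

definition color_class :: "('v, 'e) multigraph \<Rightarrow> ('e \<Rightarrow> 'c) \<Rightarrow> 'c \<Rightarrow> ('v, 'e) multigraph" where
  "color_class G f c = G\<lparr>edges := {e \<in> edges G. f e = c}\<rparr>"

definition defective_edge_coloring ::
    "nat \<Rightarrow> ('v, 'e) multigraph \<Rightarrow> ('e \<Rightarrow> 'c) \<Rightarrow> bool" where
  "defective_edge_coloring d G f \<longleftrightarrow> (\<forall>c. max_degree (color_class G f c) \<le> d)"

text \<open>
  Colors are natural numbers, which is no restriction for finite multigraphs.
\<close>

definition defective_chromatic_index :: "nat \<Rightarrow> ('v, 'e) multigraph \<Rightarrow> nat" where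
  "defective_chromatic_index d G =
    (LEAST k. \<exists>f :: 'e \<Rightarrow> nat. defective_edge_coloring d G f \<and> card (f ` edges G) \<le> k)"

text \<open>
  The vertex \<open>v\<^sub>i\<close> is the number \<open>i \<in> {1..g}\<close>. The edges \<open>(i, j)\<close>, for
  \<open>j\<close> below the multiplicity at \<open>i\<close>, are the parallel edges joining \<open>v\<^sub>i\<close> to its
  cyclic successor, which is \<open>v\<^sub>1\<close> for \<open>i = g\<close>.
\<close>

definition ring_multiplicity :: "nat \<Rightarrow> nat \<Rightarrow> nat \<Rightarrow> nat" where
  "ring_multiplicity \<Delta> g i =
    (if i = g then nat \<lfloor>real \<Delta> / 2\<rfloor>
     else if odd i then nat \<lfloor>real \<Delta> / 2\<rfloor>
     else nat \<lceil>real \<Delta> / 2\<rceil>)"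

definition almost_full_ring :: "nat \<Rightarrow> nat \<Rightarrow> (nat, nat \<times> nat) multigraph" where
  "almost_full_ring \<Delta> g =
    \<lparr>verts = {1..g},
     edges = {(i, j). i \<in> {1..g} \<and> j < ring_multiplicity \<Delta> g i},
     ends = (\<lambda>(i, j). {i, if i = g then 1 else i + 1})\<rparr>"

lemma finite_loopless_multigraph_almost_full_ring:
  assumes "g \<ge> 2"
  shows "finite_loopless_multigraph (almost_full_ring \<Delta> g)"
proof
  have "edges (almost_full_ring \<Delta> g) = (SIGMA i:{1..g}. {..<ring_multiplicity \<Delta> g i})"
    by (auto simp: almost_full_ring_def)
  then show "finite (edges (almost_full_ring \<Delta> g))"
    by simp
qed (use assms in \<open>auto simp: almost_full_ring_def card_insert_if split: if_splits\<close>)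

lemma (in finite_loopless_multigraph) defective_chromatic_index_attained:
  assumes "d \<ge> 1"
  shows "\<exists>f :: 'e \<Rightarrow> nat. defective_edge_coloring d G f \<and>
    card (f ` edges G) \<le> defective_chromatic_index d G"
proof -
  obtain f :: "'e \<Rightarrow> nat" where inj: "inj_on f (edges G)"
    using finite_imp_inj_to_nat_seg[OF finite_edges] by blast
  have "degree (color_class G f c) v \<le> d" for c v
  proof -
    have "card {e \<in> edges G. f e = c \<and> v \<in> ends G e} \<le> Suc 0"
      by (subst card_le_Suc0_iff_eq) (use finite_edges inj in \<open>auto dest: inj_onD\<close>)
    then show ?thesis
      using assms by (simp add: degree_def color_class_def conj_assoc)
  qed
  moreover have "verts (color_class G f c) = verts G" for c
    by (simp add: color_class_def)
  ultimately have "defective_edge_coloring d G f"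
    using finite_verts by (auto simp: defective_edge_coloring_def max_degree_def)
  then have "\<exists>k. \<exists>f :: 'e \<Rightarrow> nat. defective_edge_coloring d G f \<and> card (f ` edges G) \<le> k"
    by blast
  then show ?thesis
    unfolding defective_chromatic_index_def by (rule LeastI_ex)
qed

end

theory Submission
  imports Defs
begin

text \<open>
  Write \<open>d = 2s + 1\<close> and \<open>g = 2m + 1\<close>. A color class has at most \<open>(dg - 1)/2\<close> edges by the
  handshake lemma, while the ring has at least \<open>(\<Delta>g - 1)/2\<close>; this is the lower bound. For the
  upper bound, every color class receives \<open>s\<close> parallel edges at each position of the cycle and one
  additional edge at each position of a near-perfect matching. Walking around the cycle in steps
  of 2, i.e. \<open>2, 4, \<dots>, 2m, 1, 3, \<dots>, 2m + 1, 2, \<dots>\<close>, any \<open>m\<close> consecutive positions form a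
  near-perfect matching, so cutting this walk into \<open>k\<close> blocks of length \<open>m\<close> yields \<open>k\<close> matchings
  that cover the cycle as evenly as possible. The walk begins with the even positions, which are
  those of the larger multiplicity.
\<close>

section \<open>Degrees and color classes\<close>

lemma (in finite_loopless_multigraph) handshake:
  "(\<Sum>v\<in>verts G. degree G v) = 2 * card (edges G)"
proof -
  have "(\<Sum>v\<in>verts G. degree G v) = (\<Sum>e\<in>edges G. card {v \<in> verts G. v \<in> ends G e})"
    unfolding degree_def card_eq_sum
    by (rule sum.swap_restrict[OF finite_verts finite_edges])
  also have "\<dots> = (\<Sum>e\<in>edges G. 2)"
  proof (rule sum.cong)
    fix e assume e: "e \<in> edges G"
    then have "{v \<in> verts G. v \<in> ends G e} = ends G e"
      using ends_in_verts by blast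
    then show "card {v \<in> verts G. v \<in> ends G e} = 2"
      using loopless[OF e] by simp
  qed simp
  finally show ?thesis by simp
qed

lemma (in finite_loopless_multigraph) finite_loopless_multigraph_color_class:
  "finite_loopless_multigraph (color_class G f c)"
  using finite_verts finite_edges ends_in_verts loopless
  by unfold_locales (auto simp: color_class_def)

lemma (in finite_loopless_multigraph) defective_edge_coloring_iff:
  "defective_edge_coloring d G f \<longleftrightarrow>
    (\<forall>c. \<forall>v\<in>verts G. card {e \<in> edges G. f e = c \<and> v \<in> ends G e} \<le> d)"
  using finite_verts
  by (auto simp: defective_edge_coloring_def max_degree_def degree_def color_class_def conj_assoc)

text \<open>The handshake lemma is applied to each color class separately, so the rounding down
  happens once per color. For odd \<open>d * card (verts G)\<close> each color thus loses half an
  edge, the source of the -1 in the denominator of the theorem.\<close>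

lemma (in finite_loopless_multigraph) defective_edge_coloring_card_edges:
  assumes "defective_edge_coloring d G f" and "card (f ` edges G) \<le> k"
  shows "card (edges G) \<le> k * (d * card (verts G) div 2)"
proof -
  have class_le: "card {e \<in> edges G. f e = c} \<le> d * card (verts G) div 2" for c
  proof -
    interpret C: finite_loopless_multigraph "color_class G f c"
      by (rule finite_loopless_multigraph_color_class)
    have "2 * card {e \<in> edges G. f e = c} = (\<Sum>v\<in>verts G. degree (color_class G f c) v)"
      using C.handshake by (simp add: color_class_def)
    also have "\<dots> \<le> (\<Sum>v\<in>verts G. d)"
      using assms(1)
      by (intro sum_mono)
        (auto simp: defective_edge_coloring_iff degree_def color_class_def conj_assoc)
    finally show ?thesis
      by (simp add: mult.commute)
  qed
  have "card (edges G) = (\<Sum>c\<in>f ` edges G. card {e \<in> edges G. f e = c})"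
    using sum.image_gen[OF finite_edges, of "\<lambda>_. 1::nat" f] by simp
  also have "\<dots> \<le> card (f ` edges G) * (d * card (verts G) div 2)"
    using sum_bounded_above[of "f ` edges G", OF class_le] by simp
  also have "\<dots> \<le> k * (d * card (verts G) div 2)"
    using assms(2) by (rule mult_le_mono1)
  finally show ?thesis .
qed

text \<open>Parallel edges are interchangeable, so at one position only the number of edges per
  color matters, and filling the colors greedily up to their capacities suffices.\<close>

lemma ex_coloring_with_capacities:
  fixes a :: "nat \<Rightarrow> nat"
  assumes "n \<le> (\<Sum>c<k. a c)"
  shows "\<exists>f :: nat \<Rightarrow> nat. (\<forall>j<n. f j < k) \<and> (\<forall>c. card {j. j < n \<and> f j = c} \<le> a c)"
  using assms
proof (induction k arbitrary: n)
  case 0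
  then show ?case by simp
next
  case (Suc k)
  \<comment> \<open>\<open>n'\<close> counts the edges that fit into the first \<open>k\<close>
    colors; color \<open>k\<close> takes the rest.\<close>
  define n' where "n' = min n (\<Sum>c<k. a c)"
  obtain f where f: "\<And>j. j < n' \<Longrightarrow> f j < k" "\<And>c. card {j. j < n' \<and> f j = c} \<le> a c"
    using Suc.IH[of n'] by (auto simp: n'_def)
  define f' where "f' j = (if j < n' then f j else k)" for j
  have "card {j. j < n \<and> f' j = c} \<le> a c" for c
  proof (cases "c = k")
    case True
    have "f' j = k \<longleftrightarrow> n' \<le> j" for j
      using f(1)[of j] by (auto simp: f'_def)
    then have "{j. j < n \<and> f' j = c} = {n'..<n}"
      by (simp add: True set_eq_iff conj_commute)
    then show ?thesis
      using Suc.prems True by (auto simp: n'_def)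
  next
    case False
    then have "{j. j < n \<and> f' j = c} = {j. j < n' \<and> f j = c}"
      by (auto simp: f'_def n'_def split: if_splits)
    then show ?thesis
      using f(2) by simp
  qed
  moreover have "\<forall>j<n. f' j < Suc k"
    using f(1) by (auto simp: f'_def less_Suc_eq)
  ultimately show ?case by blast
qed

section \<open>The almost full ring\<close>

text \<open>The last position needs no separate case because \<open>g\<close> is odd.\<close>

lemma ring_multiplicity_odd:
  assumes "odd g"
  shows "ring_multiplicity \<Delta> g i = (if odd i then \<Delta> div 2 else (\<Delta> + 1) div 2)"
proof -
  have "nat \<lfloor>real \<Delta> / 2\<rfloor> = \<Delta> div 2"
    using floor_divide_of_nat_eq[of \<Delta> 2, where 'a = real] by simp
  moreover have "nat \<lceil>real \<Delta> / 2\<rceil> = (\<Delta> + 1) div 2"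
  proof -
    have "\<lceil>real \<Delta> / 2\<rceil> = int ((\<Delta> + 1) div 2)"
      by (cases "even \<Delta>") (auto elim!: evenE oddE simp: ceiling_eq_iff field_simps)
    then show ?thesis by simp
  qed
  ultimately show ?thesis
    using assms by (auto simp: ring_multiplicity_def)
qed

lemma card_edges_almost_full_ring:
  assumes "odd g"
  shows "\<Delta> * g \<le> 2 * card (edges (almost_full_ring \<Delta> g)) + 1"
proof -
  let ?w = "\<lambda>i. if odd i then \<Delta> div 2 else (\<Delta> + 1) div 2"
  \<comment> \<open>Positions \<open>2 * m + 2\<close> and \<open>2 * m + 3\<close> together carry
    exactly \<open>\<Delta>\<close> edges, so only the unpaired position 1 loses to rounding, at
    most 1 after doubling.\<close>
  have sum_le: "\<Delta> * (2 * m + 1) \<le>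
      2 * (\<Sum>i\<in>{1..2 * m + 1}. ?w i) + 1" for m
  proof (induction m)
    case (Suc m)
    have "{1..2 * Suc m + 1} = insert (2 * m + 3) (insert (2 * m + 2) {1..2 * m + 1})"
      by auto
    then have "(\<Sum>i\<in>{1..2 * Suc m + 1}. ?w i) =
        ?w (2 * m + 3) + (?w (2 * m + 2) + (\<Sum>i\<in>{1..2 * m + 1}. ?w i))"
      by simp
    moreover have "?w (2 * m + 3) + ?w (2 * m + 2) = \<Delta>"
      by simp
    moreover have "\<Delta> * (2 * Suc m + 1) = \<Delta> * (2 * m + 1) + 2 * \<Delta>"
      by simp
    ultimately show ?case
      using Suc by linarith
  qed simp
  have "edges (almost_full_ring \<Delta> g) = (SIGMA i:{1..g}. {..<ring_multiplicity \<Delta> g i})"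
    by (auto simp: almost_full_ring_def)
  then have "card (edges (almost_full_ring \<Delta> g)) = (\<Sum>i\<in>{1..g}. ring_multiplicity \<Delta> g i)"
    by simp
  then show ?thesis
    using sum_le[of "g div 2"] assms by (simp add: ring_multiplicity_odd)
qed

section \<open>Visits of the walk with steps of 2 on an odd cycle\<close>

text \<open>\<open>walk m i N N'\<close> is the set of times in \<open>{N<..N'}\<close> at which the walk with steps of 2 around
  the cycle of length \<open>2m + 1\<close> visits the position \<open>i\<close>.\<close>

definition walk :: "nat \<Rightarrow> nat \<Rightarrow> nat \<Rightarrow> nat \<Rightarrow> nat set" where
  "walk m i N N' = {n \<in> {N<..N'}. (2 * int m + 1) dvd (2 * int n - int i)}"

lemma finite_walk [simp]: "finite (walk m i N N')"
  by (simp add: walk_def)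

lemma sum_card_walk_blocks:
  "(\<Sum>c<k. card (walk m i (c * m) (c * m + m))) = card (walk m i 0 (k * m))"
proof (induction k)
  case (Suc k)
  have "walk m i 0 (Suc k * m) = walk m i 0 (k * m) \<union> walk m i (k * m) (k * m + m)"
    by (auto simp: walk_def)
  moreover have "walk m i 0 (k * m) \<inter> walk m i (k * m) (k * m + m) = {}"
    by (auto simp: walk_def)
  ultimately show ?case
    using Suc by (simp add: card_Un_disjoint)
qed (simp add: walk_def)

text \<open>This is the matching property of a block. Two visits to \<open>i\<close> or
  \<open>i'\<close> at times \<open>n < n'\<close> make \<open>2 * (n' - n)\<close>, changed by at
  most 1, a multiple of \<open>2 * m + 1\<close>, but within a block this number lies between 1 and
  \<open>2 * m - 1\<close>. The hypothesis is a congruence so that it also covers the last and the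
  first position.\<close>

lemma card_walk_block_adjacent:
  assumes "m \<ge> 1" and "(2 * int m + 1) dvd (int i - int i' - 1)"
  shows "card (walk m i N (N + m)) + card (walk m i' N (N + m)) \<le> 1"
proof -
  let ?g = "2 * int m + 1" and ?U = "walk m i N (N + m) \<union> walk m i' N (N + m)"
  \<comment> \<open>The offset \<open>a\<close> is 0 for a visit to \<open>i\<close> and 1 for a
    visit to \<open>i'\<close>.\<close>
  have near: "\<exists>a\<in>{0, 1}. ?g dvd (2 * int n - int i + a)" if "n \<in> ?U" for n
  proof (cases "?g dvd 2 * int n - int i")
    case False
    then have "?g dvd 2 * int n - int i'"
      using that by (auto simp: walk_def)
    then have "?g dvd (2 * int n - int i') - (int i - int i' - 1)"
      using assms(2) by (rule dvd_diff)
    then show ?thesis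
      by (simp add: algebra_simps)
  qed auto
  have "\<not> n < n'" if nn': "n \<in> ?U" "n' \<in> ?U" for n n'
  proof
    assume "n < n'"
    have bounds: "N < n" "n' \<le> N + m"
      using nn' by (auto simp: walk_def)
    obtain a b where ab: "a \<in> {0, 1}" "b \<in> {0, 1}"
      "?g dvd (2 * int n - int i + a)" "?g dvd (2 * int n' - int i + b)"
      using near nn' by meson
    have "?g dvd (2 * int n' - int i + b) - (2 * int n - int i + a)"
      using ab(4,3) by (rule dvd_diff)
    then have "?g \<le> (2 * int n' - int i + b) - (2 * int n - int i + a)"
      using ab(1,2) \<open>n < n'\<close> by (intro zdvd_imp_le) auto
    then show False
      using ab(1,2) bounds by auto
  qed
  then have "\<forall>n\<in>?U. \<forall>n'\<in>?U. n = n'"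
    by (meson linorder_neqE_nat)
  then have "card ?U \<le> 1"
    using card_le_Suc0_iff_eq[of ?U] by simp
  \<comment> \<open>A time shared by both positions would count twice, so disjointness is needed
    besides the bound on the union.\<close>
  moreover have "walk m i N (N + m) \<inter> walk m i' N (N + m) = {}"
  proof -
    have False if "?g dvd 2 * int n - int i" "?g dvd 2 * int n - int i'" for n :: nat
    proof -
      have "?g dvd (2 * int n - int i') - (2 * int n - int i) - (int i - int i' - 1)"
        using dvd_diff[OF dvd_diff[OF that(2,1)] assms(2)] .
      then have "?g dvd 1"
        by simp
      then show False
        using assms(1) zdvd_imp_le by fastforce
    qed
    then show ?thesis
      by (auto simp: walk_def)
  qed
  ultimately show ?thesis
    by (simp add: card_Un_disjoint)
qed

text \<open>Visits recur with period \<open>2 * m + 1\<close>, so one visit at time \<open>p\<close>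
  yields \<open>r\<close> visits as soon as the last, at \<open>p + (r - 1) * (2 * m + 1)\<close>,
  is at most \<open>N\<close>. The additive form of this condition avoids truncated
  subtraction.\<close>

lemma card_walk_ge:
  assumes "p \<ge> 1" and "(2 * int m + 1) dvd (2 * int p - int i)"
    and "r * (2 * m + 1) + p \<le> N + (2 * m + 1)"
  shows "r \<le> card (walk m i 0 N)"
proof -
  have "(\<lambda>q. q * (2 * m + 1) + p) ` {..<r} \<subseteq> walk m i 0 N"
  proof safe
    fix q assume "q < r"
    then have "Suc q * (2 * m + 1) \<le> r * (2 * m + 1)"
      by (intro mult_le_mono1) simp
    then have "q * (2 * m + 1) + p \<le> N"
      using assms(3) by simp
    moreover have "2 * int (q * (2 * m + 1) + p) - int i =
        (2 * int m + 1) * (2 * int q) + (2 * int p - int i)"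
      by (simp add: algebra_simps)
    then have "(2 * int m + 1) dvd 2 * int (q * (2 * m + 1) + p) - int i"
      using assms(2) by (metis dvd_add dvd_triv_left)
    ultimately show "q * (2 * m + 1) + p \<in> walk m i 0 N"
      using assms(1) by (simp add: walk_def)
  qed
  moreover have "inj_on (\<lambda>q. q * (2 * m + 1) + p) {..<r}"
    by (intro inj_onI) (simp only: add_right_cancel mult_cancel2, simp)
  ultimately have "card {..<r} \<le> card (walk m i 0 N)"
    by (metis card_image card_mono finite_walk)
  then show ?thesis by simp
qed

section \<open>Color capacities and the coloring of the ring\<close>

text \<open>The \<open>k\<close> colors supply \<open>k * s\<close> edges plus one per visit to
  \<open>i\<close> up to time \<open>k * m\<close>, so it suffices to count visits. Even positions
  may have the larger multiplicity, but their first visit is among the first \<open>m\<close> steps,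
  which makes up for it.\<close>

lemma ring_multiplicity_le_capacities:
  assumes "\<Delta> * (2 * m + 1) \<le> k * ((2 * s + 1) * (2 * m + 1) - 1) + 1"
    and "i \<in> {1..2 * m + 1}"
  shows "ring_multiplicity \<Delta> (2 * m + 1) i \<le>
    (\<Sum>c<k. s + card (walk m i (c * m) (c * m + m)))"
proof -
  let ?w = "ring_multiplicity \<Delta> (2 * m + 1) i"
  \<comment> \<open>The solution of \<open>2 * p = i\<close> modulo \<open>2 * m + 1\<close> in the
    range from 1 to \<open>2 * m + 1\<close>, that is, the first visit to \<open>i\<close>.\<close>
  define p where "p = (if even i then i div 2 else (i + (2 * m + 1)) div 2)"
  have p: "p \<ge> 1" "p \<le> 2 * m + 1" "even i \<Longrightarrow> p \<le> m"
    using assms(2) by (auto simp: p_def elim!: evenE)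
  have dvd: "(2 * int m + 1) dvd (2 * int p - int i)"
  proof (cases "even i")
    case True
    then have "2 * int p - int i = 0"
      by (auto simp: p_def elim!: evenE)
    then show ?thesis by simp
  next
    case False
    then have "2 * int p - int i = 2 * int m + 1"
      by (auto simp: p_def elim!: oddE)
    then show ?thesis by simp
  qed
  have "(2 * s + 1) * (2 * m + 1) - 1 = 2 * (s * (2 * m + 1) + m)"
    by (simp add: algebra_simps)
  then have \<Delta>: "\<Delta> * (2 * m + 1) \<le> 2 * (k * s * (2 * m + 1) + k * m) + 1"
    using assms(1) by (simp add: algebra_simps)
  \<comment> \<open>Naming the products makes the remaining comparison linear.\<close>
  define W A where "W = ?w * (2 * m + 1)" and "A = k * s * (2 * m + 1) + k * m"
  have "?w - k * s \<le> card (walk m i 0 (k * m))"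
  proof (cases "?w \<le> k * s")
    case False
    have "W + p \<le> A + (2 * m + 1)"
    proof (cases "even i")
      \<comment> \<open>Rounding up costs at most \<open>m + 1\<close> in \<open>W\<close>, which
        \<open>p \<le> m\<close> absorbs.\<close>
      case True
      then have "2 * ?w \<le> \<Delta> + 1"
        by (simp add: ring_multiplicity_odd)
      then have "2 * ?w * (2 * m + 1) \<le> (\<Delta> + 1) * (2 * m + 1)"
        by (rule mult_le_mono1)
      also have "\<dots> \<le> 2 * A + 1 + (2 * m + 1)"
        using \<Delta> by (simp add: A_def algebra_simps)
      finally have "2 * W \<le> 2 * A + 1 + (2 * m + 1)"
        by (simp only: W_def mult.assoc)
      then show ?thesis
        using p(3)[OF True] by linarith
    next
      case False
      then have "2 * ?w \<le> \<Delta>"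
        by (simp add: ring_multiplicity_odd)
      then have "2 * ?w * (2 * m + 1) \<le> \<Delta> * (2 * m + 1)"
        by (rule mult_le_mono1)
      also note \<Delta>
      finally have "2 * W \<le> 2 * A + 1"
        by (simp only: W_def A_def mult.assoc)
      then show ?thesis
        using p(2) by linarith
    qed
    then have "?w * (2 * m + 1) + p \<le> k * s * (2 * m + 1) + k * m + (2 * m + 1)"
      by (simp only: W_def A_def)
    moreover obtain r where "?w = k * s + r"
      using False by (metis le_add_diff_inverse nat_le_linear)
    ultimately have "(?w - k * s) * (2 * m + 1) + p \<le> k * m + (2 * m + 1)"
      by (simp add: algebra_simps)
    then show ?thesis
      by (rule card_walk_ge[OF p(1) dvd])
  qed simp
  then show ?thesis
    by (simp only: sum.distrib sum_card_walk_blocks) simp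
qed

text \<open>Color \<open>c\<close> gets at each position the capacity \<open>s\<close> plus the
  number of visits in block \<open>c\<close>. A vertex meets just two consecutive positions, where
  the block adds at most 1 to the load \<open>2 * s\<close>.\<close>

lemma ex_defective_edge_coloring_almost_full_ring:
  assumes "m \<ge> 1"
    and "\<Delta> * (2 * m + 1) \<le> k * ((2 * s + 1) * (2 * m + 1) - 1) + 1"
  shows "\<exists>f :: nat \<times> nat \<Rightarrow> nat.
    defective_edge_coloring (2 * s + 1) (almost_full_ring \<Delta> (2 * m + 1)) f \<and>
    card (f ` edges (almost_full_ring \<Delta> (2 * m + 1))) \<le> k"
proof -
  let ?g = "2 * m + 1"
  let ?G = "almost_full_ring \<Delta> ?g"
  let ?w = "ring_multiplicity \<Delta> ?g"
  let ?x = "\<lambda>i c. s + card (walk m i (c * m) (c * m + m))"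
  interpret finite_loopless_multigraph ?G
    using assms(1) by (intro finite_loopless_multigraph_almost_full_ring) simp
  have "\<forall>i\<in>{1..?g}. \<exists>h :: nat \<Rightarrow> nat.
      (\<forall>j < ?w i. h j < k) \<and> (\<forall>c. card {j. j < ?w i \<and> h j = c} \<le> ?x i c)"
    using ring_multiplicity_le_capacities[OF assms(2)]
    by (intro ballI ex_coloring_with_capacities)
  from bchoice[OF this] obtain h :: "nat \<Rightarrow> nat \<Rightarrow> nat"
    where h: "\<And>i j. i \<in> {1..?g} \<Longrightarrow> j < ?w i \<Longrightarrow> h i j < k"
      "\<And>i c. i \<in> {1..?g} \<Longrightarrow> card {j. j < ?w i \<and> h i j = c} \<le> ?x i c"
    by blast
  define f where "f = (\<lambda>(i, j). h i j)"
  have "card {e \<in> edges ?G. f e = c \<and> v \<in> ends ?G e} \<le> 2 * s + 1" if v: "v \<in> verts ?G" for c v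
  proof -
    \<comment> \<open>The edges at vertex \<open>v\<close> are those indexed by \<open>v\<close> and
      by its cyclic predecessor \<open>u\<close>.\<close>
    define u where "u = (if v = 1 then ?g else v - 1)"
    have uv: "v \<in> {1..?g}" "u \<in> {1..?g}"
      using v assms(1) by (auto simp: almost_full_ring_def u_def)
    let ?A = "\<lambda>i. {j. j < ?w i \<and> h i j = c}"
    have "{e \<in> edges ?G. f e = c \<and> v \<in> ends ?G e} \<subseteq> Pair v ` ?A v \<union> Pair u ` ?A u"
    proof
      fix e assume "e \<in> {e \<in> edges ?G. f e = c \<and> v \<in> ends ?G e}"
      then obtain i j where e: "e = (i, j)" "i \<in> {1..?g}" "j \<in> ?A i"
        and "v = i \<or> v = (if i = ?g then 1 else i + 1)"
        by (auto simp: almost_full_ring_def f_def)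
      then have "i = v \<or> i = u"
        unfolding u_def by (cases "i = ?g") auto
      then show "e \<in> Pair v ` ?A v \<union> Pair u ` ?A u"
        using e by blast
    qed
    then have "card {e \<in> edges ?G. f e = c \<and> v \<in> ends ?G e} \<le> card (Pair v ` ?A v \<union> Pair u ` ?A u)"
      by (intro card_mono) auto
    also have "\<dots> \<le> card (Pair v ` ?A v) + card (Pair u ` ?A u)"
      by (rule card_Un_le)
    also have "\<dots> \<le> card (?A v) + card (?A u)"
      by (intro add_mono card_image_le) auto
    also have "\<dots> \<le> ?x v c + ?x u c"
      using h(2) uv by (intro add_mono) auto
    also have "\<dots> \<le> 2 * s + 1"
    proof -
      have "(2 * int m + 1) dvd (int v - int u - 1)"
      proof (cases "v = 1")
        case True
        then have "int v - int u - 1 = - (2 * int m + 1)"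
          by (simp add: u_def)
        then show ?thesis
          by (simp only: dvd_minus_iff dvd_refl)
      next
        case False
        then show ?thesis
          using uv(1) by (simp add: u_def of_nat_diff)
      qed
      then show ?thesis
        using card_walk_block_adjacent[OF assms(1), of v u "c * m"] by simp
    qed
    finally show ?thesis .
  qed
  then have "defective_edge_coloring (2 * s + 1) ?G f"
    unfolding defective_edge_coloring_iff by blast
  moreover have "f ` edges ?G \<subseteq> {..<k}"
    using h(1) by (auto simp: almost_full_ring_def f_def)
  then have "card (f ` edges ?G) \<le> k"
    using card_mono[of "{..<k}" "f ` edges ?G"] by simp
  ultimately show ?thesis by blast
qed

theorem lemma2p8:
  fixes d g\<^sub>0 \<Delta> :: nat
  assumes "odd d" and "d > 1" and "odd g\<^sub>0" and "g\<^sub>0 \<ge> 3" and "\<Delta> > d"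
  shows "int (defective_chromatic_index d (almost_full_ring \<Delta> g\<^sub>0)) =
    \<lceil>(real \<Delta> * real g\<^sub>0 - 1) / (real d * real g\<^sub>0 - 1)\<rceil>"
proof -
  let ?G = "almost_full_ring \<Delta> g\<^sub>0"
  obtain s where s: "d = 2 * s + 1"
    using assms(1) by (rule oddE)
  obtain m where m: "g\<^sub>0 = 2 * m + 1"
    using assms(3) by (rule oddE)
  interpret finite_loopless_multigraph ?G
    using assms(4) by (intro finite_loopless_multigraph_almost_full_ring) simp
  have dg: "1 < d * g\<^sub>0" "odd (d * g\<^sub>0)"
    using less_1_mult[of d g\<^sub>0] assms(1-4) by simp_all
  \<comment> \<open>Both sides are equivalent to
    \<open>\<Delta> * g\<^sub>0 \<le> k * (d * g\<^sub>0 - 1) + 1\<close>, so the feasible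
    \<open>k\<close> are exactly those from the ceiling on.\<close>
  have colorable_iff: "(\<exists>f :: nat \<times> nat \<Rightarrow> nat.
        defective_edge_coloring d ?G f \<and> card (f ` edges ?G) \<le> k) \<longleftrightarrow>
      \<lceil>(real \<Delta> * real g\<^sub>0 - 1) / (real d * real g\<^sub>0 - 1)\<rceil> \<le> int k"
    (is "?L k \<longleftrightarrow> ?c \<le> _") for k
  proof -
    have "real (d * g\<^sub>0 - 1) > 0"
      using dg(1) by (simp only: of_nat_0_less_iff zero_less_diff)
    moreover have "real d * real g\<^sub>0 - 1 = real (d * g\<^sub>0 - 1)"
      using of_nat_diff[OF less_imp_le[OF dg(1)], where 'a = real]
      by (simp only: of_nat_mult of_nat_1)
    ultimately have "?c \<le> int k \<longleftrightarrow> real \<Delta> * real g\<^sub>0 - 1 \<le> real k * real (d * g\<^sub>0 - 1)"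
      by (simp add: ceiling_le_iff divide_le_eq)
    also have "\<dots> \<longleftrightarrow> real (\<Delta> * g\<^sub>0) \<le> real (k * (d * g\<^sub>0 - 1) + 1)"
      by (simp only: of_nat_mult of_nat_add of_nat_1 diff_le_eq)
    also have "\<dots> \<longleftrightarrow> \<Delta> * g\<^sub>0 \<le> k * (d * g\<^sub>0 - 1) + 1"
      by (rule of_nat_le_iff)
    finally have c_le: "?c \<le> int k \<longleftrightarrow> \<Delta> * g\<^sub>0 \<le> k * (d * g\<^sub>0 - 1) + 1" .
    have "\<Delta> * g\<^sub>0 \<le> k * (d * g\<^sub>0 - 1) + 1" if "?L k"
    proof -
      have "card (edges ?G) \<le> k * (d * card (verts ?G) div 2)"
        using that defective_edge_coloring_card_edges by blast
      then have "2 * card (edges ?G) \<le> k * (2 * (d * g\<^sub>0 div 2))"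
        by (simp add: almost_full_ring_def)
      also have "2 * (d * g\<^sub>0 div 2) = d * g\<^sub>0 - 1"
        using odd_two_times_div_two_nat[OF dg(2)] .
      finally show ?thesis
        using card_edges_almost_full_ring[OF assms(3), of \<Delta>] by linarith
    qed
    moreover have "?L k" if "\<Delta> * g\<^sub>0 \<le> k * (d * g\<^sub>0 - 1) + 1"
      using ex_defective_edge_coloring_almost_full_ring[of m \<Delta> k s] that assms(4,5)
      unfolding s m by simp
    ultimately show ?thesis
      using c_le by blast
  qed
  have "defective_chromatic_index d ?G = nat ?c"
    unfolding defective_chromatic_index_def colorable_iff
    by (rule Least_equality) linarith+
  \<comment> \<open>Nonnegativity allows \<open>nat\<close> to be removed from the ceiling.\<close>
  moreover have "?c \<ge> 0"
  proof -
    have "real \<Delta> * real g\<^sub>0 \<ge> 1" "real d * real g\<^sub>0 \<ge> 1"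
      using assms(2,4,5) by (simp_all flip: of_nat_mult)
    then have "(real \<Delta> * real g\<^sub>0 - 1) / (real d * real g\<^sub>0 - 1) \<ge> 0"
      by (intro divide_nonneg_nonneg) auto
    then show ?thesis by linarith
  qed
  ultimately show ?thesis by simp
qed

end
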